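(* Let $n\ge2$. When $n$ is even, the following statistics are homomesic for permutations in $S_n$ with parity rotation, with the indicated average over every orbit of $parrot$: (1) the number of cyclical small weak excedances (average $2$); (2) the number of indices that are not cyclical small weak excedances (average $n-2$). When $n$ is odd, the following statistics are homomesic for permutations in $S_n$ with parity rotation, with the indicated average over every orbit of $parrot$: (3) the number of descents (average $\frac{n-1}{2}$); (4) the number of ascents (average $\frac{n-1}{2}$); (5) the number of runs (average $\frac{n+1}{2}$); (6) the width of the tree associated to the permutation (average $\frac{n+1}{2}$); (7) the number of strict 3-descents (average $\frac{n-3}{2}$).
   Context: $[n]=\{1,\dots,n\}$; $S_n$ is the set of permutations of $[n]$, in one-line notation $\pi=\pi(1)\pi(2)\cdots\pi(n)$. The parity rotation map $parrot:S_n\to S_n$ is $parrot(\pi)=\pi(3)\pi(4)\pi(5)\cdots\pi(n)\pi(1)\pi(2)$ if $n$ is even, and $parrot(\pi)=\pi(3)\pi(4)\pi(5)\cdots\pi(n)\pi(2)\pi(1)$ if $n$ is odd. A statistic $st$ is homomesic with average $c$ for a bijection if $\frac{1}{\#\mathcal{O}}\sum_{x\in\mathcal{O}}st(x)=c$ for every orbit $\mathcal{O}$ of the bijection. An index $i\in[n]$ is a cyclical small weak excedance of $\pi$ if $\pi(i)=i$ or $\pi(i)\equiv i+1\pmod n$. A descent (resp. ascent) is an $i\in[n-1]$ with $\pi(i)>\pi(i+1)$ (resp. $\pi(i)<\pi(i+1)$). A run is a maximal contiguous increasing subsequence of the one-line notation. A strict 3-descent is an index $i$ with $1\le i\le n-3$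 and $\pi(i)>\pi(i+3)$. The tree associated to $\pi$ is the rooted tree on $\{0,1,\dots,n\}$ with root $0$ in which the parent of $v\in[n]$ is the rightmost entry of $\pi$ that precedes $v$ in one-line notation and is smaller than $v$, or $0$ if there is no such entry; its width is its number of leaves. *)

theory Defs
  imports
    Complex_Main
    "HOL-Combinatorics.Permutations"
    "HOL-Combinatorics.Orbits"
    "HOL-Number_Theory.Cong"
begin

text \<open>
  Permutations of \<open>{1..n}\<close> are functions \<open>nat \<Rightarrow> nat\<close> with \<open>\<pi> permutes {1..n}\<close>;
  the one-line notation of \<open>\<pi>\<close> is \<open>\<pi> 1, \<dots>, \<pi> n\<close>.
\<close>

definition Sym :: "nat \<Rightarrow> (nat \<Rightarrow> nat) set" where
  "Sym n = {\<pi>. \<pi> permutes {1..n}}"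

text \<open>
  The first case only keeps points outside \<open>{1..n}\<close> fixed, as \<open>permutes\<close> requires.
\<close>

definition parrot :: "nat \<Rightarrow> (nat \<Rightarrow> nat) \<Rightarrow> (nat \<Rightarrow> nat)" where
  "parrot n \<pi> = (\<lambda>i.
     if i \<notin> {1..n} then i
     else if i + 2 \<le> n then \<pi> (i + 2)
     else if i + 1 = n then (if even n then \<pi> 1 else \<pi> 2)
     else (if even n then \<pi> 2 else \<pi> 1))"

text \<open>
  The library's \<open>orbit f x\<close> consists of the iterates of \<open>f\<close> at \<open>x\<close> with positive exponent.
  For a bijection of a finite set \<open>S\<close> and \<open>x \<in> S\<close> this is the usual orbit,
  so ranging over \<open>x \<in> S\<close> ranges over all orbits.
\<close>

definition homomesic :: "'a set \<Rightarrow> ('a \<Rightarrow> 'a) \<Rightarrow> ('a \<Rightarrow> real) \<Rightarrow> real \<Rightarrow> bool" where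
  "homomesic S f st c \<longleftrightarrow>
     finite S \<and> bij_betw f S S \<and>
     (\<forall>x\<in>S. (1 / real (card (orbit f x))) * (\<Sum>y\<in>orbit f x. st y) = c)"

definition cyc_small_weak_exc :: "nat \<Rightarrow> (nat \<Rightarrow> nat) \<Rightarrow> nat \<Rightarrow> bool" where
  "cyc_small_weak_exc n \<pi> i \<longleftrightarrow> \<pi> i = i \<or> [\<pi> i = i + 1] (mod n)"

definition descents :: "nat \<Rightarrow> (nat \<Rightarrow> nat) \<Rightarrow> nat set" where
  "descents n \<pi> = {i. 1 \<le> i \<and> i + 1 \<le> n \<and> \<pi> i > \<pi> (i + 1)}"

definition ascents :: "nat \<Rightarrow> (nat \<Rightarrow> nat) \<Rightarrow> nat set" where
  "ascents n \<pi> = {i. 1 \<le> i \<and> i + 1 \<le> n \<and> \<pi> i < \<pi> (i + 1)}"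

definition strict_3_descents :: "nat \<Rightarrow> (nat \<Rightarrow> nat) \<Rightarrow> nat set" where
  "strict_3_descents n \<pi> = {i. 1 \<le> i \<and> i + 3 \<le> n \<and> \<pi> i > \<pi> (i + 3)}"

text \<open>
  A contiguous subsequence \<open>\<pi> a, \<dots>, \<pi> b\<close> is encoded by the pair \<open>(a, b)\<close>
  of its first and last position.
\<close>

definition increasing_segment :: "nat \<Rightarrow> (nat \<Rightarrow> nat) \<Rightarrow> nat \<Rightarrow> nat \<Rightarrow> bool" where
  "increasing_segment n \<pi> a b \<longleftrightarrow> 1 \<le> a \<and> a \<le> b \<and> b \<le> n \<and> strict_mono_on {a..b} \<pi>"

definition runs :: "nat \<Rightarrow> (nat \<Rightarrow> nat) \<Rightarrow> (nat \<times> nat) set" where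
  "runs n \<pi> = {(a, b). increasing_segment n \<pi> a b \<and>
     (\<forall>a' b'. increasing_segment n \<pi> a' b' \<and> a' \<le> a \<and> b \<le> b' \<longrightarrow> a' = a \<and> b' = b)}"

text \<open>
  The entry \<open>v\<close> stands at position \<open>inv \<pi> v\<close> of the one-line notation.
\<close>

definition tree_parent :: "(nat \<Rightarrow> nat) \<Rightarrow> nat \<Rightarrow> nat" where
  "tree_parent \<pi> v =
     (let J = {j. 1 \<le> j \<and> j < inv \<pi> v \<and> \<pi> j < v}
      in if J = {} then 0 else \<pi> (Max J))"

text \<open>
  Leaves are the vertices without children; in particular the root, having a child
  whenever \<open>n \<ge> 1\<close>, is not counted even if it has degree one.
\<close>

definition tree_leaves :: "nat \<Rightarrow> (nat \<Rightarrow> nat) \<Rightarrow> nat set" where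
  "tree_leaves n \<pi> = {u \<in> {0..n}. \<forall>v\<in>{1..n}. tree_parent \<pi> v \<noteq> u}"

definition tree_width :: "nat \<Rightarrow> (nat \<Rightarrow> nat) \<Rightarrow> nat" where
  "tree_width n \<pi> = card (tree_leaves n \<pi>)"

end

theory Submission
  imports Defs
begin

text \<open>
  Parity rotation rotates the entries in the odd positions cyclically among the odd positions,
  of which there are \<open>p = (n + 1) div 2\<close>, and the entries in the even positions cyclically among
  the \<open>q = n div 2\<close> even positions.  Homomesy can be tested by averaging along a fixed number
  \<open>T\<close> of iterates instead of along the orbit (\<open>homomesicI\<close>), so each statistic is written as a
  sum over positions, and the average at each position is computed along the iterates.

  For even \<open>n\<close> take \<open>T = p = q\<close>.  Every value visits every position of its own parity class
  exactly once.  A value \<open>v\<close> is counted when it stands in position \<open>v\<close> or, cyclically, in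
  position \<open>v - 1\<close>, and exactly one of these two positions lies in the class through which \<open>v\<close>
  travels.  Hence the \<open>n\<close> values are counted \<open>n\<close> times during \<open>n/2\<close> iterates, which gives the
  average \<open>2\<close>.

  For odd \<open>n\<close> the lengths \<open>p\<close> and \<open>q\<close> are consecutive, hence coprime, and \<open>T = p * q\<close>.  By the
  Chinese remainder theorem any odd position and any even position together display every pair
  of an odd-position entry and an even-position entry exactly once.  Two positions at a fixed odd
  distance have opposite parities; if \<open>W\<close> of the \<open>p * q\<close> pairs have their larger entry in an odd
  position, then positions \<open>i\<close> and \<open>i + d\<close> are inverted \<open>W\<close> times when \<open>i\<close> is odd and
  \<open>p * q - W\<close> times when \<open>i\<close> is even.  There are equally many \<open>i\<close> of both kinds, so every
  statistic of this type has average \<open>(n - d) / 2\<close> (\<open>homomesic_gap_descents\<close>).  Distance 1 gives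
  descents and distance 3 gives strict 3-descents.  Ascents, runs and tree width are
  affine functions of the number of descents: a run ends, and a leaf of the tree stands, exactly
  at a descent or at the last position.
\<close>

section \<open>Homomesy by averaging along iterates\<close>

lemma orbit_subset:
  assumes "x \<in> S" "f ` S \<subseteq> S"
  shows "orbit f x \<subseteq> S"
proof
  fix y assume "y \<in> orbit f x"
  then show "y \<in> S" by induction (use assms in auto)
qed

text \<open>
  Summing the hypothesis over all points of an orbit counts each point of the orbit \<open>T\<close> times,
  since every power of \<open>f\<close> permutes the orbit.  In particular \<open>T\<close> may differ from the length of
  the orbit.
\<close>

lemma homomesicI:
  assumes fin: "finite S" and bij: "bij_betw f S S" and T: "T > 0"
    and avg: "\<And>x. x \<in> S \<Longrightarrow> (\<Sum>k<T. st ((f ^^ k) x)) = real T * c"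
  shows "homomesic S f st c"
  unfolding homomesic_def
proof (intro conjI ballI fin bij)
  fix x assume x: "x \<in> S"
  let ?O = "orbit f x"
  have OS: "?O \<subseteq> S"
    using bij by (intro orbit_subset x) (auto simp: bij_betw_def)
  have finO: "finite ?O"
    using OS fin by (rule finite_subset)
  have bijO: "bij_betw f ?O ?O"
  proof -
    have "inj_on f ?O"
      using bij OS by (auto simp: bij_betw_def intro: inj_on_subset)
    moreover have "f ` ?O \<subseteq> ?O"
      by (auto intro: orbit.step)
    ultimately show ?thesis
      using finO by (simp add: bij_betw_def endo_inj_surj)
  qed
  have "bij_betw (f ^^ k) ?O ?O" for k
    using bijO by (rule bij_betw_funpow)
  then have shift: "(\<Sum>y\<in>?O. st ((f ^^ k) y)) = (\<Sum>y\<in>?O. st y)" for k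
    by (rule sum.reindex_bij_betw)
  have "real T * (\<Sum>y\<in>?O. st y) = (\<Sum>k<T. \<Sum>y\<in>?O. st ((f ^^ k) y))"
    by (simp add: shift)
  also have "\<dots> = (\<Sum>y\<in>?O. \<Sum>k<T. st ((f ^^ k) y))"
    by (rule sum.swap)
  also have "\<dots> = (\<Sum>y\<in>?O. real T * c)"
    using OS by (intro sum.cong refl avg) auto
  finally have "real T * (\<Sum>y\<in>?O. st y) = real T * (real (card ?O) * c)"
    by simp
  then have "(\<Sum>y\<in>?O. st y) = real (card ?O) * c"
    using T by simp
  moreover have "card ?O > 0"
    using finO by (auto simp: card_gt_0_iff intro: orbit.base)
  ultimately show "1 / real (card ?O) * (\<Sum>y\<in>?O. st y) = c"
    by simp
qed

lemma homomesic_affine: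
  assumes hom: "homomesic S f st c"
    and aff: "\<And>y. y \<in> S \<Longrightarrow> st' y = a * st y + b"
  shows "homomesic S f st' (a * c + b)"
  unfolding homomesic_def
proof (intro conjI ballI)
  show fin: "finite S" and bij: "bij_betw f S S"
    using hom by (auto simp: homomesic_def)
  fix x assume x: "x \<in> S"
  let ?O = "orbit f x"
  have OS: "?O \<subseteq> S"
    using bij by (intro orbit_subset x) (auto simp: bij_betw_def)
  then have finO: "finite ?O"
    using fin by (rule finite_subset)
  have card: "card ?O > 0"
    using finO by (auto simp: card_gt_0_iff intro: orbit.base)
  have "(\<Sum>y\<in>?O. st' y) = (\<Sum>y\<in>?O. a * st y + b)"
    using OS by (intro sum.cong refl aff) auto
  also have "\<dots> = a * (\<Sum>y\<in>?O. st y) + b * real (card ?O)"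
    by (simp add: sum.distrib sum_distrib_left)
  also have "(\<Sum>y\<in>?O. st y) = c * real (card ?O)"
    using hom x card by (auto simp: homomesic_def field_simps)
  finally show "1 / real (card ?O) * (\<Sum>y\<in>?O. st' y) = a * c + b"
    using card by (simp add: field_simps)
qed

section \<open>Parity rotation and its iterates\<close>

lemma parrot_odd_position:
  assumes "j < (n + 1) div 2"
  shows "parrot n \<pi> (2 * j + 1) = \<pi> (2 * ((j + 1) mod ((n + 1) div 2)) + 1)"
proof (cases "j + 1 = (n + 1) div 2")
  case True
  with assms consider "n = 2 * j + 1" | "n = 2 * j + 2" by linarith
  then show ?thesis
    using True by cases (simp_all add: parrot_def)
next
  case False
  with assms have j: "j + 1 < (n + 1) div 2" by simp
  then have "2 * j + 3 \<le> n" by linarith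
  with j show ?thesis
    by (simp add: parrot_def)
qed

lemma parrot_even_position:
  assumes "j < n div 2"
  shows "parrot n \<pi> (2 * j + 2) = \<pi> (2 * ((j + 1) mod (n div 2)) + 2)"
proof (cases "j + 1 = n div 2")
  case True
  with assms consider "n = 2 * j + 2" | "n = 2 * j + 3" by linarith
  then show ?thesis
    using True by cases (simp_all add: parrot_def, simp_all only: numeral_2_eq_2)
next
  case False
  with assms have j: "j + 1 < n div 2" by simp
  then have "2 * j + 4 \<le> n" by linarith
  with j show ?thesis
    by (simp add: parrot_def)
qed

lemma funpow_parrot_odd_position:
  assumes "j < (n + 1) div 2"
  shows "(parrot n ^^ k) \<pi> (2 * j + 1) = \<pi> (2 * ((j + k) mod ((n + 1) div 2)) + 1)"
  using assms
proof (induction k arbitrary: j)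
  case 0
  then show ?case by simp
next
  case (Suc k)
  let ?p = "(n + 1) div 2"
  have "(j + 1) mod ?p < ?p"
    using Suc.prems by simp
  from Suc.IH[OF this] show ?case
    using parrot_odd_position[OF Suc.prems] by (simp add: mod_simps)
qed

lemma funpow_parrot_even_position:
  assumes "j < n div 2"
  shows "(parrot n ^^ k) \<pi> (2 * j + 2) = \<pi> (2 * ((j + k) mod (n div 2)) + 2)"
  using assms
proof (induction k arbitrary: j)
  case 0
  then show ?case by simp
next
  case (Suc k)
  let ?q = "n div 2"
  have "(j + 1) mod ?q < ?q"
    using Suc.prems by simp
  from Suc.IH[OF this] show ?case
    using parrot_even_position[OF Suc.prems] by (simp add: mod_simps)
qed

lemma parrot_id_permutes:
  assumes "n \<ge> 2"
  shows "parrot n id permutes {1..n}"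
proof (rule bij_imp_permutes)
  have "inj_on (parrot n id) {1..n}"
    using assms by (auto simp: inj_on_def parrot_def split: if_splits)
  moreover have "parrot n id ` {1..n} \<subseteq> {1..n}"
    using assms by (auto simp: parrot_def)
  ultimately show "bij_betw (parrot n id) {1..n} {1..n}"
    by (simp add: bij_betw_def endo_inj_surj)
qed (simp add: parrot_def)

text \<open>
  Being the permutation of positions that \<open>parrot\<close> performs, \<open>parrot n id\<close> represents the map as
  right multiplication by a fixed element, which makes its bijectivity evident.
\<close>

lemma parrot_eq_comp:
  assumes "\<pi> \<in> Sym n"
  shows "parrot n \<pi> = \<pi> \<circ> parrot n id"
  using assms by (auto simp: fun_eq_iff parrot_def Sym_def permutes_not_in)

lemma Sym_eq_iff:
  assumes "\<pi> \<in> Sym n"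
  shows "\<pi> a = \<pi> b \<longleftrightarrow> a = b"
  using assms by (auto simp: Sym_def dest: permutes_inj inj_eq)

lemma finite_Sym: "finite (Sym n)"
  by (simp add: Sym_def finite_permutations)

lemma bij_betw_parrot:
  assumes "n \<ge> 2"
  shows "bij_betw (parrot n) (Sym n) (Sym n)"
proof -
  note perm = parrot_id_permutes[OF assms]
  have "parrot n ` Sym n \<subseteq> Sym n"
    using perm by (auto simp: parrot_eq_comp) (auto simp: Sym_def intro: permutes_compose)
  moreover have "inj_on (parrot n) (Sym n)"
  proof (rule inj_onI)
    fix \<pi> \<rho> assume "\<pi> \<in> Sym n" "\<rho> \<in> Sym n" "parrot n \<pi> = parrot n \<rho>"
    then have "\<pi> \<circ> parrot n id = \<rho> \<circ> parrot n id"
      by (simp flip: parrot_eq_comp)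
    then show "\<pi> = \<rho>"
      using permutes_surj[OF perm] by (metis surj_fun_eq fun.set_map image_comp)
  qed
  ultimately show ?thesis
    by (simp add: bij_betw_def endo_inj_surj finite_Sym)
qed

lemma card_eq_sum_of_bool:
  assumes "finite A"
  shows "real (card {i \<in> A. P i}) = (\<Sum>i\<in>A. of_bool (P i))"
  using assms by (simp add: sum.If_cases of_bool_def Int_def)

lemma sum_split_parity:
  "(\<Sum>i\<in>{1..2 * e}. g i) = (\<Sum>j<e. g (2 * j + 1) + g (2 * j + 2))"
  for g :: "nat \<Rightarrow> 'a::comm_monoid_add"
  by (induction e) (simp_all add: add.assoc)

section \<open>Cyclical small weak excedances\<close>

lemma sum_rotate:
  fixes g :: "nat \<Rightarrow> 'a::comm_monoid_add"
  shows "(\<Sum>k<m. g ((j + k) mod m)) = (\<Sum>r<m. g r)"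
proof (rule sum.reindex_bij_betw)
  have "inj_on (\<lambda>k. (j + k) mod m) {..<m}"
    by (auto simp: inj_on_def simp flip: cong_def
        dest!: cong_add_lcancel_nat[THEN iffD1] cong_less_modulus_unique_nat)
  moreover have "(\<lambda>k. (j + k) mod m) ` {..<m} \<subseteq> {..<m}"
    by auto
  ultimately show "bij_betw (\<lambda>k. (j + k) mod m) {..<m} {..<m}"
    by (simp add: bij_betw_def endo_inj_surj)
qed

lemma cong_succ_iff:
  fixes v i n :: nat
  assumes "v \<in> {1..n}" "i \<in> {1..n}"
  shows "[v = i + 1] (mod n) \<longleftrightarrow> (if i = n then v = 1 else v = i + 1)"
proof (cases "i = n")
  case True
  have "[v = n + 1] (mod n) \<longleftrightarrow> v mod n = 1 mod n"
    by (simp only: cong_def mod_add_self1)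
  also have "\<dots> \<longleftrightarrow> v = 1"
  proof (cases "v = n")
    case True
    then show ?thesis
      using assms by (cases "n = 1") (auto simp: mod_less)
  next
    case False
    then have "v < n" "1 < n" using assms by auto
    then show ?thesis by simp
  qed
  finally show ?thesis using True by simp
next
  case False
  then have "[v = i + 1] (mod n) \<longleftrightarrow> v = i + 1"
    using assms by (cases "v = n"; cases "i + 1 = n") (auto simp: cong_def)
  then show ?thesis using False by simp
qed

text \<open>
  Among the odd positions the unique candidate for a value \<open>v\<close> is the smaller element of the
  block \<open>{2 j + 1, 2 j + 2}\<close> containing \<open>v\<close>; among the even positions the blocks are shifted by
  one, and the value 1 belongs to the block of the last position.
\<close>

lemma sum_exc_odd_positions:
  fixes v m :: nat
  assumes "v \<in> {1..2 * m}"
  shows "(\<Sum>j<m. of_bool (v = 2 * j + 1 \<or> [v = 2 * j + 1 + 1] (mod 2 * m))) = (1::real)"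
proof -
  have "(\<Sum>j<m. of_bool (v = 2 * j + 1 \<or> [v = 2 * j + 1 + 1] (mod 2 * m)))
      = (\<Sum>j<m. if (v - 1) div 2 = j then 1 else (0::real))"
  proof (rule sum.cong)
    fix j assume j: "j \<in> {..<m}"
    have "v = 2 * j + 1 \<or> [v = 2 * j + 1 + 1] (mod 2 * m) \<longleftrightarrow> v = 2 * j + 1 \<or> v = 2 * j + 2"
      using assms j by (subst cong_succ_iff) auto
    also have "\<dots> \<longleftrightarrow> (v - 1) div 2 = j"
      using assms by auto
    finally show "of_bool (v = 2 * j + 1 \<or> [v = 2 * j + 1 + 1] (mod 2 * m))
        = (if (v - 1) div 2 = j then 1 else (0::real))"
      by (simp add: of_bool_def)
  qed simp
  also have "\<dots> = 1"
    using assms by (auto simp: sum.delta)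
  finally show ?thesis .
qed

lemma sum_exc_even_positions:
  fixes v m :: nat
  assumes "v \<in> {1..2 * m}"
  shows "(\<Sum>j<m. of_bool (v = 2 * j + 2 \<or> [v = 2 * j + 2 + 1] (mod 2 * m))) = (1::real)"
proof -
  let ?b = "if v = 1 then m - 1 else (v - 2) div 2"
  have "(\<Sum>j<m. of_bool (v = 2 * j + 2 \<or> [v = 2 * j + 2 + 1] (mod 2 * m)))
      = (\<Sum>j<m. if ?b = j then 1 else (0::real))"
  proof (rule sum.cong)
    fix j assume j: "j \<in> {..<m}"
    have "v = 2 * j + 2 \<or> [v = 2 * j + 2 + 1] (mod 2 * m)
        \<longleftrightarrow> v = 2 * j + 2 \<or> (if 2 * j + 2 = 2 * m then v = 1 else v = 2 * j + 3)"
      using assms j by (subst cong_succ_iff) auto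
    also have "\<dots> \<longleftrightarrow> ?b = j"
    proof (cases "v = 1")
      case True
      then show ?thesis using j by auto
    next
      case False
      with assms obtain w where w: "v = w + 2"
        using nat_le_iff_add[of 2 v] by (auto simp: add.commute)
      have "w = 2 * j \<or> 2 * j + 2 \<noteq> 2 * m \<and> w = 2 * j + 1 \<longleftrightarrow> w div 2 = j"
        using assms w by auto
      then show ?thesis using w by auto
    qed
    finally show "of_bool (v = 2 * j + 2 \<or> [v = 2 * j + 2 + 1] (mod 2 * m))
        = (if ?b = j then 1 else (0::real))"
      by (simp add: of_bool_def)
  qed simp
  also have "\<dots> = 1"
    using assms by (auto simp: sum.delta)
  finally show ?thesis .
qed

text \<open>
  The count is organised by the entry: for a fixed position, the sum over the \<open>m\<close> iterates becomes
  a sum over the entries of that parity class, and after exchanging the sums each entry contributes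
  exactly 1.
\<close>

theorem homomesic_cyc_small_weak_exc:
  assumes "n \<ge> 2" "even n"
  shows "homomesic (Sym n) (parrot n)
    (\<lambda>\<pi>. real (card {i \<in> {1..n}. cyc_small_weak_exc n \<pi> i})) 2"
proof -
  obtain m where n: "n = 2 * m" and m: "m > 0"
    using assms by (auto elim!: evenE)
  show ?thesis
  proof (rule homomesicI[OF finite_Sym bij_betw_parrot[OF assms(1)] m])
    fix \<pi> assume "\<pi> \<in> Sym n"
    then have range: "\<pi> i \<in> {1..2 * m}" if "i \<in> {1..2 * m}" for i
      using that n by (auto simp: Sym_def permutes_in_image simp del: atLeastAtMost_iff)
    define P where "P v i = (of_bool (v = i \<or> [v = i + 1] (mod 2 * m)) :: real)" for v i :: nat
    let ?f = "\<lambda>k. (parrot n ^^ k) \<pi>"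
    have odds: "(\<Sum>k<m. P (?f k (2 * j + 1)) (2 * j + 1)) = (\<Sum>r<m. P (\<pi> (2 * r + 1)) (2 * j + 1))"
      if "j < m" for j
    proof -
      have "?f k (2 * j + 1) = \<pi> (2 * ((j + k) mod m) + 1)" for k
        using funpow_parrot_odd_position[of j n k \<pi>] that n by simp
      then show ?thesis
        using sum_rotate[of "\<lambda>r. P (\<pi> (2 * r + 1)) (2 * j + 1)" j m] by (simp only:)
    qed
    have evens: "(\<Sum>k<m. P (?f k (2 * j + 2)) (2 * j + 2)) = (\<Sum>r<m. P (\<pi> (2 * r + 2)) (2 * j + 2))"
      if "j < m" for j
    proof -
      have "?f k (2 * j + 2) = \<pi> (2 * ((j + k) mod m) + 2)" for k
        using funpow_parrot_even_position[of j n k \<pi>] that n by simp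
      then show ?thesis
        using sum_rotate[of "\<lambda>r. P (\<pi> (2 * r + 2)) (2 * j + 2)" j m] by (simp only:)
    qed
    have one_odd: "(\<Sum>j<m. P (\<pi> (2 * r + 1)) (2 * j + 1)) = 1" if "r < m" for r
      unfolding P_def by (rule sum_exc_odd_positions, rule range) (use that in auto)
    have one_even: "(\<Sum>j<m. P (\<pi> (2 * r + 2)) (2 * j + 2)) = 1" if "r < m" for r
      unfolding P_def by (rule sum_exc_even_positions, rule range) (use that in auto)
    have "(\<Sum>k<m. real (card {i \<in> {1..n}. cyc_small_weak_exc n (?f k) i}))
        = (\<Sum>k<m. \<Sum>i\<in>{1..2 * m}. P (?f k i) i)"
      by (simp only: card_eq_sum_of_bool[OF finite_atLeastAtMost] cyc_small_weak_exc_def P_def n)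
    also have "\<dots> = (\<Sum>k<m. \<Sum>j<m. P (?f k (2 * j + 1)) (2 * j + 1) + P (?f k (2 * j + 2)) (2 * j + 2))"
      by (simp only: sum_split_parity)
    also have "\<dots> = (\<Sum>j<m. (\<Sum>k<m. P (?f k (2 * j + 1)) (2 * j + 1))
                          + (\<Sum>k<m. P (?f k (2 * j + 2)) (2 * j + 2)))"
      by (subst sum.swap) (simp only: sum.distrib)
    also have "\<dots> = (\<Sum>j<m. (\<Sum>r<m. P (\<pi> (2 * r + 1)) (2 * j + 1))
                          + (\<Sum>r<m. P (\<pi> (2 * r + 2)) (2 * j + 2)))"
      by (intro sum.cong arg_cong2[where f = "(+)"] refl odds evens) auto
    also have "\<dots> = (\<Sum>j<m. \<Sum>r<m. P (\<pi> (2 * r + 1)) (2 * j + 1))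
                  + (\<Sum>j<m. \<Sum>r<m. P (\<pi> (2 * r + 2)) (2 * j + 2))"
      by (rule sum.distrib)
    also have "(\<Sum>j<m. \<Sum>r<m. P (\<pi> (2 * r + 1)) (2 * j + 1)) = (\<Sum>r<m. 1)"
      by (subst sum.swap) (intro sum.cong refl one_odd, auto)
    also have "(\<Sum>j<m. \<Sum>r<m. P (\<pi> (2 * r + 2)) (2 * j + 2)) = (\<Sum>r<m. 1)"
      by (subst sum.swap) (intro sum.cong refl one_even, auto)
    finally show "(\<Sum>k<m. real (card {i \<in> {1..n}. cyc_small_weak_exc n (?f k) i})) = real m * 2"
      by simp
  qed
qed

section \<open>Descents at an odd distance\<close>

text \<open>
  This is the Chinese remainder theorem: while \<open>k\<close> runs through the residues modulo \<open>p * q\<close>, the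
  pair of residues runs once through all pairs, from whatever offsets \<open>i\<close> and \<open>j\<close> it starts.
\<close>

lemma sum_rotate_pair:
  fixes g :: "nat \<Rightarrow> nat \<Rightarrow> 'a::comm_monoid_add"
  assumes "coprime p q"
  shows "(\<Sum>k<p * q. g ((i + k) mod p) ((j + k) mod q)) = (\<Sum>r<p. \<Sum>s<q. g r s)"
proof -
  let ?h = "\<lambda>k. ((i + k) mod p, (j + k) mod q)"
  have "inj_on ?h {..<p * q}"
  proof (rule inj_onI)
    fix k l assume kl: "k \<in> {..<p * q}" "l \<in> {..<p * q}" and "?h k = ?h l"
    then have "[k = l] (mod p)" "[k = l] (mod q)"
      by (auto simp: cong_add_lcancel_nat simp flip: cong_def)
    then have "[k = l] (mod p * q)"
      using assms by (rule coprime_cong_mult_nat)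
    then show "k = l"
      using kl by (auto intro: cong_less_modulus_unique_nat)
  qed
  moreover have "?h ` {..<p * q} \<subseteq> {..<p} \<times> {..<q}"
  proof (rule image_subsetI)
    fix k assume "k \<in> {..<p * q}"
    then have "p > 0" "q > 0" by (auto intro!: gr0I)
    then show "?h k \<in> {..<p} \<times> {..<q}" by simp
  qed
  ultimately have "bij_betw ?h {..<p * q} ({..<p} \<times> {..<q})"
    by (simp add: bij_betw_def card_subset_eq card_image)
  then have "(\<Sum>k<p * q. case ?h k of (r, s) \<Rightarrow> g r s) = (\<Sum>(r, s)\<in>{..<p} \<times> {..<q}. g r s)"
    by (rule sum.reindex_bij_betw)
  then show ?thesis
    by (simp add: sum.cartesian_product)
qed

text \<open>
  A descent over the gap \<open>d\<close> compares an entry from an odd position with one from an even position,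
  in an order that depends on the parity of its starting position.  The two orders count
  complementary sets of pairs of entries, so two neighbouring starting positions together
  contribute \<open>p * q\<close> during the \<open>p * q\<close> iterates.  The \<open>n - d\<close> starting positions form
  \<open>(n - d) / 2\<close> such pairs.
\<close>

theorem homomesic_gap_descents:
  assumes n: "odd n" "n \<ge> 2" and d: "odd d" "d \<le> n"
  shows "homomesic (Sym n) (parrot n)
    (\<lambda>\<pi>. real (card {i. 1 \<le> i \<and> i + d \<le> n \<and> \<pi> i > \<pi> (i + d)})) ((real n - real d) / 2)"
proof -
  obtain q where nq: "n = 2 * q + 1" and q: "q > 0"
    using n by (auto elim!: oddE)
  obtain c where dc: "d = 2 * c + 1"
    using d by (auto elim!: oddE)
  define p where "p = q + 1"
  define e where "e = q - c"
  have e: "n - d = 2 * e" "real n - real d = 2 * real e" "e + c = q"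
    using d nq dc by (auto simp: e_def of_nat_diff)
  have coprime: "coprime p q"
    by (simp add: p_def)
  have pq: "p * q > 0"
    using q by (simp add: p_def)
  show ?thesis
  proof (rule homomesicI[OF finite_Sym bij_betw_parrot[OF n(2)] pq])
    fix \<pi> assume "\<pi> \<in> Sym n"
    then have inj: "\<pi> a = \<pi> b \<longleftrightarrow> a = b" for a b
      by (rule Sym_eq_iff)
    let ?f = "\<lambda>k. (parrot n ^^ k) \<pi>"
    have odd_pos: "?f k (2 * j + 1) = \<pi> (2 * ((j + k) mod p) + 1)" if "j < p" for j k
      using funpow_parrot_odd_position[of j n k \<pi>] that nq by (simp add: p_def)
    have even_pos: "?f k (2 * j + 2) = \<pi> (2 * ((j + k) mod q) + 2)" if "j < q" for j k
      using funpow_parrot_even_position[of j n k \<pi>] that nq by simp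
    define G where "G r s = (of_bool (\<pi> (2 * r + 1) > \<pi> (2 * s + 2)) :: real)" for r s
    have not_G: "of_bool (\<pi> (2 * s + 2) > \<pi> (2 * r + 1)) = 1 - G r s" for r s
    proof -
      have "2 * s + 2 \<noteq> 2 * r + 1" by presburger
      then have "\<pi> (2 * s + 2) \<noteq> \<pi> (2 * r + 1)" by (simp add: inj)
      then show ?thesis by (auto simp: G_def)
    qed
    \<comment> \<open>The number of inverted pairs when the position on the left is the odd one.\<close>
    define W where "W = (\<Sum>r<p. \<Sum>s<q. G r s)"
    have odd_start: "(\<Sum>k<p * q. of_bool (?f k (2 * j + 1) > ?f k (2 * j + 1 + d))) = W"
      if "j < e" for j
    proof -
      have "j < p" "j + c < q"
        using that e by (auto simp: p_def)
      moreover have "2 * j + 1 + d = 2 * (j + c) + 2"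
        by (simp add: dc)
      ultimately have "of_bool (?f k (2 * j + 1) > ?f k (2 * j + 1 + d))
          = G ((j + k) mod p) ((j + c + k) mod q)" for k
        by (simp only: G_def odd_pos even_pos)
      then show ?thesis
        by (simp only: sum_rotate_pair[OF coprime] W_def)
    qed
    have even_start: "(\<Sum>k<p * q. of_bool (?f k (2 * j + 2) > ?f k (2 * j + 2 + d))) = real (p * q) - W"
      if "j < e" for j
    proof -
      have "j < q" "j + c + 1 < p"
        using that e by (auto simp: p_def)
      moreover have "2 * j + 2 + d = 2 * (j + c + 1) + 1"
        by (simp add: dc)
      ultimately have "of_bool (?f k (2 * j + 2) > ?f k (2 * j + 2 + d))
          = 1 - G ((j + c + 1 + k) mod p) ((j + k) mod q)" for k
        by (simp only: not_G odd_pos even_pos)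
      then show ?thesis
        by (simp only: sum_subtractf sum_rotate_pair[OF coprime] W_def) simp
    qed
    have set_eq: "{i. 1 \<le> i \<and> i + d \<le> n \<and> \<rho> i > \<rho> (i + d)}
        = {i \<in> {1..2 * e}. \<rho> i > \<rho> (i + d)}" for \<rho> :: "nat \<Rightarrow> nat"
      using d by (auto simp flip: e(1))
    have "(\<Sum>k<p * q. real (card {i. 1 \<le> i \<and> i + d \<le> n \<and> ?f k i > ?f k (i + d)}))
        = (\<Sum>k<p * q. \<Sum>i\<in>{1..2 * e}. of_bool (?f k i > ?f k (i + d)))"
      by (simp only: set_eq card_eq_sum_of_bool[OF finite_atLeastAtMost])
    also have "\<dots> = (\<Sum>i\<in>{1..2 * e}. \<Sum>k<p * q. of_bool (?f k i > ?f k (i + d)))"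
      by (rule sum.swap)
    also have "\<dots> = (\<Sum>j<e. (\<Sum>k<p * q. of_bool (?f k (2 * j + 1) > ?f k (2 * j + 1 + d)))
                          + (\<Sum>k<p * q. of_bool (?f k (2 * j + 2) > ?f k (2 * j + 2 + d))))"
      by (rule sum_split_parity)
    also have "\<dots> = (\<Sum>j<e. W + (real (p * q) - W))"
      by (intro sum.cong arg_cong2[where f = "(+)"] refl odd_start even_start) auto
    finally show "(\<Sum>k<p * q. real (card {i. 1 \<le> i \<and> i + d \<le> n \<and> ?f k i > ?f k (i + d)}))
        = real (p * q) * ((real n - real d) / 2)"
      by (simp add: e(2))
  qed
qed

section \<open>Statistics determined by the number of descents\<close>

lemma finite_descents: "finite (descents n \<pi>)"
  by (rule finite_subset[of _ "{1..n}"]) (auto simp: descents_def)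

lemma card_insert_descents: "card (insert n (descents n \<pi>)) = card (descents n \<pi>) + 1"
  using finite_descents by (simp add: descents_def)

lemma card_ascents:
  assumes "\<pi> \<in> Sym n" "n \<ge> 1"
  shows "real (card (ascents n \<pi>)) = (real n - 1) - real (card (descents n \<pi>))"
proof -
  have "\<pi> i \<noteq> \<pi> (i + 1)" for i
    using Sym_eq_iff[OF assms(1)] by simp
  then have "ascents n \<pi> \<union> descents n \<pi> = {1..n - 1}"
    using assms(2) by (fastforce simp: ascents_def descents_def nat_neq_iff)
  moreover have "ascents n \<pi> \<inter> descents n \<pi> = {}"
    by (auto simp: ascents_def descents_def)
  moreover have "finite (ascents n \<pi>)"
    by (rule finite_subset[of _ "{1..n}"]) (auto simp: ascents_def)
  ultimately have "card {1..n - 1} = card (ascents n \<pi>) + card (descents n \<pi>)"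
    using card_Un_disjoint[OF _ finite_descents] by metis
  then show ?thesis
    using assms(2) by (simp add: of_nat_diff)
qed

lemma increasing_segment_extend:
  assumes "increasing_segment n \<pi> a b" "b + 1 \<le> n" "\<pi> b < \<pi> (b + 1)"
  shows "increasing_segment n \<pi> a (b + 1)"
proof -
  have mono: "strict_mono_on {a..b} \<pi>" and ab: "1 \<le> a" "a \<le> b"
    using assms(1) by (auto simp: increasing_segment_def)
  have "\<pi> i < \<pi> j" if ij: "a \<le> i" "i < j" "j \<le> b + 1" for i j
  proof (cases "j = b + 1")
    case False
    then show ?thesis
      using ij mono by (intro strict_mono_onD[OF mono]) auto
  next
    case True
    have "\<pi> i \<le> \<pi> b"
      using ij True ab strict_mono_onD[OF mono, of i b] by (cases "i = b") auto
    then show ?thesis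
      using True assms(3) by simp
  qed
  then show ?thesis
    using ab assms(2) by (auto simp: increasing_segment_def strict_mono_on_def)
qed

text \<open>
  A run is determined by its last position, because the longer of two increasing segments with
  a common end contains the other.
\<close>

lemma card_runs:
  assumes "\<pi> \<in> Sym n" "n \<ge> 1"
  shows "card (runs n \<pi>) = card (descents n \<pi>) + 1"
proof -
  have neq: "\<pi> i \<noteq> \<pi> (i + 1)" for i
    using Sym_eq_iff[OF assms(1)] by simp
  have "inj_on snd (runs n \<pi>)"
  proof (rule inj_onI, clarsimp)
    fix a a' b assume "(a, b) \<in> runs n \<pi>" "(a', b) \<in> runs n \<pi>"
    then show "a = a'"
      unfolding runs_def by (cases "a \<le> a'") (auto, (metis nle_le order_refl)+)
  qed
  moreover have "snd ` runs n \<pi> = insert n (descents n \<pi>)"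
  proof (intro equalityI subsetI)
    fix b assume "b \<in> snd ` runs n \<pi>"
    then obtain a where seg: "increasing_segment n \<pi> a b"
      and maxi: "\<And>a' b'. increasing_segment n \<pi> a' b' \<Longrightarrow> a' \<le> a \<Longrightarrow> b \<le> b' \<Longrightarrow> b' = b"
      by (auto simp: runs_def)
    have b: "1 \<le> b" "b \<le> n"
      using seg by (auto simp: increasing_segment_def)
    show "b \<in> insert n (descents n \<pi>)"
    proof (cases "b = n")
      case False
      then have "\<not> \<pi> b < \<pi> (b + 1)"
        using increasing_segment_extend[OF seg] maxi[of a "b + 1"] b by fastforce
      then show ?thesis
        using neq[of b] b False by (auto simp: descents_def)
    qed simp
  next
    fix b assume b: "b \<in> insert n (descents n \<pi>)"
    then have "increasing_segment n \<pi> b b"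
      using assms(2) by (auto simp: increasing_segment_def descents_def strict_mono_on_def)
    \<comment> \<open>The run ending at \<open>b\<close> is obtained by extending the segment as far to the left as possible.\<close>
    define a where "a = (LEAST a. increasing_segment n \<pi> a b)"
    have seg: "increasing_segment n \<pi> a b"
      unfolding a_def by (rule LeastI) fact
    have "a' = a \<and> b' = b" if seg': "increasing_segment n \<pi> a' b'" and sub: "a' \<le> a" "b \<le> b'" for a' b'
    proof
      have ab: "a \<le> b"
        using seg by (simp add: increasing_segment_def)
      show "b' = b"
      proof (rule ccontr)
        assume "b' \<noteq> b"
        then have "b < b'" using sub by simp
        then have "\<pi> b < \<pi> (b + 1)" "b + 1 \<le> n"
          using seg' sub ab by (auto simp: increasing_segment_def strict_mono_on_def)
        then show False
          using b by (auto simp: descents_def)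
      qed
      then have "a \<le> a'"
        using seg' unfolding a_def by (auto intro: Least_le)
      then show "a' = a" using sub by simp
    qed
    with seg have "(a, b) \<in> runs n \<pi>"
      by (auto simp: runs_def)
    then show "b \<in> snd ` runs n \<pi>" by force
  qed
  ultimately show ?thesis
    by (metis card_image card_insert_descents)
qed

text \<open>
  At an ascent \<open>\<pi> i < \<pi> (i + 1)\<close> the entry \<open>\<pi> (i + 1)\<close> is a child of \<open>\<pi> i\<close>.  At a descent
  \<open>\<pi> i\<close> has no child, since for every later entry exceeding \<open>\<pi> i\<close> the smaller and more recent
  entry \<open>\<pi> (i + 1)\<close> is preferred.
\<close>

lemma tree_parent_eq_iff_ascent:
  assumes "\<pi> \<in> Sym n" and i: "i \<in> {1..n}"
  shows "(\<exists>v\<in>{1..n}. tree_parent \<pi> v = \<pi> i) \<longleftrightarrow> i + 1 \<le> n \<and> \<pi> i < \<pi> (i + 1)"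
proof -
  have perm: "\<pi> permutes {1..n}"
    using assms by (simp add: Sym_def)
  have inv: "inv \<pi> (\<pi> k) = k" for k
    using permutes_inverses[OF perm] by simp
  have inj: "\<pi> a = \<pi> b \<longleftrightarrow> a = b" for a b
    using assms(1) by (rule Sym_eq_iff)
  have range: "\<pi> k \<in> {1..n} \<longleftrightarrow> k \<in> {1..n}" for k
    using permutes_in_image[OF perm] .
  show ?thesis
  proof
    assume asc: "i + 1 \<le> n \<and> \<pi> i < \<pi> (i + 1)"
    let ?J = "{j. 1 \<le> j \<and> j < i + 1 \<and> \<pi> j < \<pi> (i + 1)}"
    have "Max ?J = i"
      using asc i by (intro Max_eqI) (auto intro: finite_subset[of _ "{..i}"])
    moreover have "?J \<noteq> {}"
      using asc i by auto
    ultimately have "tree_parent \<pi> (\<pi> (i + 1)) = \<pi> i"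
      unfolding tree_parent_def Let_def inv by (simp only: if_False)
    moreover have "\<pi> (i + 1) \<in> {1..n}"
      using asc by (simp only: range) simp
    ultimately show "\<exists>v\<in>{1..n}. tree_parent \<pi> v = \<pi> i"
      by blast
  next
    assume "\<exists>v\<in>{1..n}. tree_parent \<pi> v = \<pi> i"
    then obtain v where v: "v \<in> {1..n}" "tree_parent \<pi> v = \<pi> i" by blast
    obtain k where k: "v = \<pi> k"
      using permutes_surj[OF perm] by (metis surjD)
    then have kn: "k \<in> {1..n}"
      using v range by simp
    define J where "J = {j. 1 \<le> j \<and> j < k \<and> \<pi> j < v}"
    have parent: "tree_parent \<pi> v = (if J = {} then 0 else \<pi> (Max J))"
      unfolding tree_parent_def Let_def J_def k inv by (rule refl)
    \<comment> \<open>Since \<open>\<pi> i\<close> is positive, the parent is not the default value 0 for the root.\<close>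
    have "\<pi> i \<ge> 1"
      using range[of i] i by auto
    then have J: "J \<noteq> {}" "i = Max J"
      using parent v(2) by (auto simp: inj split: if_splits)
    have fin: "finite J"
      by (rule finite_subset[of _ "{..k}"]) (auto simp: J_def)
    have "i \<in> J"
      using Max_in[OF fin J(1)] J(2) by simp
    then have ik: "i < k" "\<pi> i < v"
      by (auto simp: J_def)
    \<comment> \<open>Otherwise \<open>i + 1\<close> would also be a candidate position, beyond the maximal one.\<close>
    have "\<pi> i < \<pi> (i + 1)"
    proof (rule ccontr)
      assume "\<not> \<pi> i < \<pi> (i + 1)"
      then have less: "\<pi> (i + 1) < v"
        using ik(2) by linarith
      then have "i + 1 \<noteq> k"
        using k by blast
      then have "i + 1 < k"
        using ik(1) by linarith
      with less have "i + 1 \<in> J"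
        by (simp add: J_def)
      then show False
        using Max_ge[OF fin, of "i + 1"] J(2) by simp
    qed
    then show "i + 1 \<le> n \<and> \<pi> i < \<pi> (i + 1)"
      using ik kn by simp
  qed
qed

lemma tree_width_eq:
  assumes "\<pi> \<in> Sym n" "n \<ge> 1"
  shows "tree_width n \<pi> = card (descents n \<pi>) + 1"
proof -
  have perm: "\<pi> permutes {1..n}"
    using assms by (simp add: Sym_def)
  have inj: "inj \<pi>"
    using perm by (rule permutes_inj)
  have neq: "\<pi> i \<noteq> \<pi> (i + 1)" for i
    using Sym_eq_iff[OF assms(1)] by simp
  have leaf_iff: "\<pi> i \<in> tree_leaves n \<pi> \<longleftrightarrow> i \<in> insert n (descents n \<pi>)" if i: "i \<in> {1..n}" for i
  proof -
    have "\<pi> i \<in> {1..n}"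
      using permutes_in_image[OF perm] i by blast
    then have "\<pi> i \<in> tree_leaves n \<pi> \<longleftrightarrow> \<not> (i + 1 \<le> n \<and> \<pi> i < \<pi> (i + 1))"
      unfolding tree_parent_eq_iff_ascent[OF assms(1) i, symmetric] by (auto simp: tree_leaves_def)
    also have "\<dots> \<longleftrightarrow> i \<in> insert n (descents n \<pi>)"
      using i neq[of i] by (auto simp: descents_def)
    finally show ?thesis .
  qed
  \<comment> \<open>The first entry is a child of the root.\<close>
  have "0 \<notin> tree_leaves n \<pi>"
  proof -
    have "tree_parent \<pi> (\<pi> 1) = 0"
      using permutes_inverses[OF perm] by (auto simp: tree_parent_def)
    moreover have "\<pi> 1 \<in> {1..n}"
      using permutes_in_image[OF perm, of 1] assms(2) by simp
    ultimately show ?thesis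
      by (auto simp: tree_leaves_def)
  qed
  then have "tree_leaves n \<pi> \<subseteq> {1..n}"
    by (auto simp: tree_leaves_def Suc_le_eq intro!: gr0I)
  then have "tree_leaves n \<pi> \<subseteq> \<pi> ` {1..n}"
    using permutes_image[OF perm] by simp
  moreover have "insert n (descents n \<pi>) \<subseteq> {1..n}"
    using assms(2) by (auto simp: descents_def)
  ultimately have "tree_leaves n \<pi> = \<pi> ` insert n (descents n \<pi>)"
    using leaf_iff by blast
  then show ?thesis
    unfolding tree_width_def using inj
    by (metis card_image card_insert_descents inj_on_subset subset_UNIV)
qed

section \<open>Homomesies for parity rotation\<close>

theorem theorem4p3:
  fixes n :: nat
  assumes "n \<ge> 2"
  shows
    "(even n \<longrightarrow>
        homomesic (Sym n) (parrot n)
          (\<lambda>\<pi>. real (card {i \<in> {1..n}. cyc_small_weak_exc n \<pi> i})) 2 \<and>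
        homomesic (Sym n) (parrot n)
          (\<lambda>\<pi>. real (card {i \<in> {1..n}. \<not> cyc_small_weak_exc n \<pi> i})) (real n - 2))
     \<and>
     (odd n \<longrightarrow>
        homomesic (Sym n) (parrot n) (\<lambda>\<pi>. real (card (descents n \<pi>))) ((real n - 1) / 2) \<and>
        homomesic (Sym n) (parrot n) (\<lambda>\<pi>. real (card (ascents n \<pi>))) ((real n - 1) / 2) \<and>
        homomesic (Sym n) (parrot n) (\<lambda>\<pi>. real (card (runs n \<pi>))) ((real n + 1) / 2) \<and>
        homomesic (Sym n) (parrot n) (\<lambda>\<pi>. real (tree_width n \<pi>)) ((real n + 1) / 2) \<and>
        homomesic (Sym n) (parrot n) (\<lambda>\<pi>. real (card (strict_3_descents n \<pi>))) ((real n - 3) / 2))"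
proof (intro conjI impI)
  note n = \<open>n \<ge> 2\<close>
  assume "even n"
  show exc: "homomesic (Sym n) (parrot n)
      (\<lambda>\<pi>. real (card {i \<in> {1..n}. cyc_small_weak_exc n \<pi> i})) 2"
    using n \<open>even n\<close> by (rule homomesic_cyc_small_weak_exc)
  have "real (card {i \<in> {1..n}. \<not> cyc_small_weak_exc n \<pi> i})
      = - 1 * real (card {i \<in> {1..n}. cyc_small_weak_exc n \<pi> i}) + real n" for \<pi>
    by (simp only: card_eq_sum_of_bool[OF finite_atLeastAtMost] of_bool_not_iff sum_subtractf) simp
  from homomesic_affine[OF exc this]
  show "homomesic (Sym n) (parrot n)
      (\<lambda>\<pi>. real (card {i \<in> {1..n}. \<not> cyc_small_weak_exc n \<pi> i})) (real n - 2)"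
    by simp
next
  note n = \<open>n \<ge> 2\<close>
  assume odd: "odd n"
  have n3: "n \<ge> 3"
    using n odd by (cases "n = 2") auto
  show desc: "homomesic (Sym n) (parrot n) (\<lambda>\<pi>. real (card (descents n \<pi>))) ((real n - 1) / 2)"
    using homomesic_gap_descents[OF odd n, of 1] n by (simp add: descents_def)
  show "homomesic (Sym n) (parrot n) (\<lambda>\<pi>. real (card (strict_3_descents n \<pi>))) ((real n - 3) / 2)"
    using homomesic_gap_descents[OF odd n, of 3] n3 by (simp add: strict_3_descents_def)
  have "homomesic (Sym n) (parrot n) (\<lambda>\<pi>. real (card (ascents n \<pi>)))
      (- 1 * ((real n - 1) / 2) + (real n - 1))"
    using desc by (rule homomesic_affine) (use n in \<open>simp add: card_ascents\<close>)
  also have "- 1 * ((real n - 1) / 2) + (real n - 1) = (real n - 1) / 2"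
    by (simp add: field_simps)
  finally show "homomesic (Sym n) (parrot n) (\<lambda>\<pi>. real (card (ascents n \<pi>))) ((real n - 1) / 2)" .
  have avg: "1 * ((real n - 1) / 2) + 1 = (real n + 1) / 2"
    by (simp add: field_simps)
  have "homomesic (Sym n) (parrot n) (\<lambda>\<pi>. real (card (runs n \<pi>))) (1 * ((real n - 1) / 2) + 1)"
    using desc by (rule homomesic_affine) (use n in \<open>simp add: card_runs\<close>)
  then show "homomesic (Sym n) (parrot n) (\<lambda>\<pi>. real (card (runs n \<pi>))) ((real n + 1) / 2)"
    by (simp only: avg)
  have "homomesic (Sym n) (parrot n) (\<lambda>\<pi>. real (tree_width n \<pi>)) (1 * ((real n - 1) / 2) + 1)"
    using desc by (rule homomesic_affine) (use n in \<open>simp add: tree_width_eq\<close>)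
  then show "homomesic (Sym n) (parrot n) (\<lambda>\<pi>. real (tree_width n \<pi>)) ((real n + 1) / 2)"
    by (simp only: avg)
qed

end
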